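(* Let $G$ be a finitely generated group which is transport amenable. Then for every $p \in (1,\infty)$ the degree one reduced $\ell^p$-cohomology of $G$ vanishes, i.e. $\overline{\ell^p H}^1(\mathrm{Cay}(G,S)) = \{0\}$ for every finite symmetric generating set $S$ of $G$.
   Context: For a finite symmetric generating set $S$ of $G$, the Cayley graph $\Gamma=\mathrm{Cay}(G,S)$ has vertex set $G$ and edge set $E=\{(\gamma,\gamma') : \exists s\in S,\ s^{-1}\gamma=\gamma'\}$; $d_\Gamma$ is its graph distance. Functions take values in $\mathbb{K}=\mathbb{R}$ or $\mathbb{C}$. The gradient of $g:G\to\mathbb{K}$ is $\nabla g(\gamma,\gamma')=g(\gamma')-g(\gamma)$. The space of $p$-Dirichlet functions is $D^p(\Gamma)=\{f:G\to\mathbb{K} : \nabla f\in \ell^p(E)\}$ with norm $\|f\|_{D^p}^p=\|\nabla f\|_{\ell^p(E)}^p+|f(e)|^p$. The degree one reduced $\ell^p$-cohomology is $\overline{\ell^p H}^1(\Gamma)=D^p(\Gamma)/\overline{\ell^p(G)+\mathbb{K}}^{D^p}$ (closure in the $D^p$-norm, $\mathbb{K}$ denoting constant functions); it does not depend on the choice of $S$ up to isomorphism. The left and right regular actions are $(\lambda_\gamma f)(x)=f(\gamma^{-1}x)$ and $(\rho_\gamma f)(x)=f(x\gamma)$. For a function $\xi$ on $G$ set $\xi^\vee(x)=\xi(x^{-1})$ (so $\rho_s\xi^\vee=(\lambda_s\xi)^\vee$). A sequence of finitely supported probability measures $\xi_n$ on $G$ converges to a left-invariant mean if $\|\lambda_\gamma\xi_n-\xi_n\|_{\ell^1(G)}\to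 0$ for every $\gamma\in G$. For finitely supported probability measures $\xi,\phi$ on $G$, the transport cost is $\mathrm{trc}(\xi,\phi)=\inf_{m\in M(\xi,\phi)}\int_{G\times G} d_\Gamma(x,y)\,dm(x,y)$, where $M(\xi,\phi)$ is the set of finitely supported measures on $G\times G$ with marginals $\xi$ and $\phi$. The group $G$ is called transport amenable if there exist a finite (symmetric) generating set $S$, a constant $K>0$ and a sequence of finitely supported probability measures $\xi_n$ converging to a left-invariant mean such that for all $s\in S$ and all $n$, $\mathrm{trc}(\rho_s\xi_n^\vee,\xi_n^\vee)\le K$ (distance taken in $\mathrm{Cay}(G,S)$). *)

theory Defs
  imports "HOL-Analysis.Analysis" "HOL-Algebra.Algebra"
begin

definition fin_sym_gen_set :: "('a, 'b) monoid_scheme \<Rightarrow> 'a set \<Rightarrow> bool" where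
  "fin_sym_gen_set G S \<longleftrightarrow> finite S \<and> S \<subseteq> carrier G \<and> (\<forall>s\<in>S. inv\<^bsub>G\<^esub> s \<in> S)
     \<and> generate G S = carrier G"

definition finitely_generated :: "('a, 'b) monoid_scheme \<Rightarrow> bool" where
  "finitely_generated G \<longleftrightarrow> (\<exists>S. finite S \<and> S \<subseteq> carrier G \<and> generate G S = carrier G)"

definition cay_edges :: "('a, 'b) monoid_scheme \<Rightarrow> 'a set \<Rightarrow> ('a \<times> 'a) set" where
  "cay_edges G S = {(x, y). x \<in> carrier G \<and> (\<exists>s\<in>S. inv\<^bsub>G\<^esub> s \<otimes>\<^bsub>G\<^esub> x = y)}"

fun cay_walk :: "('a, 'b) monoid_scheme \<Rightarrow> 'a \<Rightarrow> 'a list \<Rightarrow> 'a" where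
  "cay_walk G x [] = x"
| "cay_walk G x (s # ws) = cay_walk G (inv\<^bsub>G\<^esub> s \<otimes>\<^bsub>G\<^esub> x) ws"

definition cay_dist :: "('a, 'b) monoid_scheme \<Rightarrow> 'a set \<Rightarrow> 'a \<Rightarrow> 'a \<Rightarrow> nat" where
  "cay_dist G S x y = (LEAST n. \<exists>ws. length ws = n \<and> set ws \<subseteq> S \<and> cay_walk G x ws = y)"

definition grad :: "('a \<Rightarrow> 'k::real_normed_field) \<Rightarrow> 'a \<times> 'a \<Rightarrow> 'k" where
  "grad g e = g (snd e) - g (fst e)"

definition lp_set :: "real \<Rightarrow> 'i set \<Rightarrow> ('i \<Rightarrow> 'k::real_normed_field) \<Rightarrow> bool" where
  "lp_set p I u \<longleftrightarrow> (\<lambda>i. norm (u i) powr p) summable_on I"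

definition Dp :: "('a, 'b) monoid_scheme \<Rightarrow> 'a set \<Rightarrow> real \<Rightarrow> ('a \<Rightarrow> 'k::real_normed_field) \<Rightarrow> bool" where
  "Dp G S p f \<longleftrightarrow> lp_set p (cay_edges G S) (grad f)"

definition Dp_norm :: "('a, 'b) monoid_scheme \<Rightarrow> 'a set \<Rightarrow> real \<Rightarrow> ('a \<Rightarrow> 'k::real_normed_field) \<Rightarrow> real" where
  "Dp_norm G S p f = ((\<Sum>\<^sub>\<infinity>e\<in>cay_edges G S. norm (grad f e) powr p) + norm (f \<one>\<^bsub>G\<^esub>) powr p) powr (1 / p)"

text \<open>The reduced cohomology D^p / closure(l^p(G) + K) is zero iff every p-Dirichlet
  function lies in the D^p-closure of l^p(G) + constants.\<close>
definition reduced_lp_H1_vanishes ::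
  "('a, 'b) monoid_scheme \<Rightarrow> 'a set \<Rightarrow> real \<Rightarrow> ('a \<Rightarrow> 'k::real_normed_field) itself \<Rightarrow> bool" where
  "reduced_lp_H1_vanishes G S p _ \<longleftrightarrow>
     (\<forall>f :: 'a \<Rightarrow> 'k. Dp G S p f \<longrightarrow>
        (\<forall>\<epsilon>>0. \<exists>g c. lp_set p (carrier G) g \<and> Dp G S p (\<lambda>x. f x - g x - c)
              \<and> Dp_norm G S p (\<lambda>x. f x - g x - c) < \<epsilon>))"

definition fs_prob :: "('a, 'b) monoid_scheme \<Rightarrow> ('a \<Rightarrow> real) \<Rightarrow> bool" where
  "fs_prob G \<xi> \<longleftrightarrow> finite {x. \<xi> x \<noteq> 0} \<and> {x. \<xi> x \<noteq> 0} \<subseteq> carrier G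
     \<and> (\<forall>x. \<xi> x \<ge> 0) \<and> (\<Sum>x\<in>{x. \<xi> x \<noteq> 0}. \<xi> x) = 1"

definition left_reg :: "('a, 'b) monoid_scheme \<Rightarrow> 'a \<Rightarrow> ('a \<Rightarrow> 'k) \<Rightarrow> 'a \<Rightarrow> 'k" where
  "left_reg G \<gamma> f x = f (inv\<^bsub>G\<^esub> \<gamma> \<otimes>\<^bsub>G\<^esub> x)"

definition right_reg :: "('a, 'b) monoid_scheme \<Rightarrow> 'a \<Rightarrow> ('a \<Rightarrow> 'k) \<Rightarrow> 'a \<Rightarrow> 'k" where
  "right_reg G \<gamma> f x = f (x \<otimes>\<^bsub>G\<^esub> \<gamma>)"

definition check :: "('a, 'b) monoid_scheme \<Rightarrow> ('a \<Rightarrow> 'k) \<Rightarrow> 'a \<Rightarrow> 'k" where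
  "check G f x = f (inv\<^bsub>G\<^esub> x)"

definition conv_left_inv_mean :: "('a, 'b) monoid_scheme \<Rightarrow> (nat \<Rightarrow> 'a \<Rightarrow> real) \<Rightarrow> bool" where
  "conv_left_inv_mean G \<xi> \<longleftrightarrow> (\<forall>\<gamma>\<in>carrier G.
     (\<lambda>n. \<Sum>\<^sub>\<infinity>x\<in>carrier G. \<bar>left_reg G \<gamma> (\<xi> n) x - \<xi> n x\<bar>) \<longlonglongrightarrow> 0)"

definition couplings :: "('a, 'b) monoid_scheme \<Rightarrow> ('a \<Rightarrow> real) \<Rightarrow> ('a \<Rightarrow> real) \<Rightarrow> ('a \<times> 'a \<Rightarrow> real) set" where
  "couplings G \<xi> \<phi> = {m. finite {z. m z \<noteq> 0} \<and> {z. m z \<noteq> 0} \<subseteq> carrier G \<times> carrier G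
      \<and> (\<forall>z. m z \<ge> 0)
      \<and> (\<forall>x\<in>carrier G. (\<Sum>\<^sub>\<infinity>y\<in>carrier G. m (x, y)) = \<xi> x)
      \<and> (\<forall>y\<in>carrier G. (\<Sum>\<^sub>\<infinity>x\<in>carrier G. m (x, y)) = \<phi> y)}"

definition trc :: "('a, 'b) monoid_scheme \<Rightarrow> 'a set \<Rightarrow> ('a \<Rightarrow> real) \<Rightarrow> ('a \<Rightarrow> real) \<Rightarrow> real" where
  "trc G S \<xi> \<phi> = Inf ((\<lambda>m. \<Sum>\<^sub>\<infinity>z\<in>carrier G \<times> carrier G. real (cay_dist G S (fst z) (snd z)) * m z)
                        ` couplings G \<xi> \<phi>)"

definition transport_amenable :: "('a, 'b) monoid_scheme \<Rightarrow> bool" where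
  "transport_amenable G \<longleftrightarrow> (\<exists>S C \<xi>. fin_sym_gen_set G S \<and> C > 0
      \<and> (\<forall>n. fs_prob G (\<xi> n)) \<and> conv_left_inv_mean G \<xi>
      \<and> (\<forall>s\<in>S. \<forall>n. trc G S (right_reg G s (check G (\<xi> n))) (check G (\<xi> n)) \<le> C))"

end

theory Submission
  imports Defs
begin

text \<open>Truncation shows that bounded functions are dense among the \<open>p\<close>-Dirichlet functions, so let \<open>f\<close>
  be bounded. Its averages \<open>F n = \<lambda>(\<xi> n) f\<close> differ from \<open>f\<close> by elements of \<open>\<ell>\<^sup>p\<close>. The derivative of
  \<open>F n\<close> along \<open>s\<close> at \<open>x\<close> is the pairing of \<open>\<rho>\<^sub>s check (\<xi> n) - check (\<xi> n)\<close> with \<open>\<rho>\<^sub>x f\<close>. Telescoping along a transport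
  plan bounds its norm by the transport cost times the norm of the gradient of \<open>f\<close>, while asymptotic
  invariance of \<open>\<xi> n\<close> and boundedness of \<open>f\<close> make it tend to zero pointwise. Bounded pointwise null
  sequences have averages tending to zero in norm because \<open>p > 1\<close>, so some average of the \<open>F n\<close> has
  arbitrarily small gradient.\<close>

section \<open>Norm bounds in l^p over an index set\<close>

text \<open>Says that the l^p norm over \<open>I\<close> is at most \<open>R\<close>. Finite partial
  sums avoid summability side conditions, and \<open>R \<ge> 0\<close> keeps \<open>R powr p\<close>
  monotone in \<open>R\<close>.\<close>

definition lp_bdd :: "real \<Rightarrow> 'i set \<Rightarrow> ('i \<Rightarrow> 'k::real_normed_vector) \<Rightarrow> real \<Rightarrow> bool" where
  "lp_bdd p I u R \<longleftrightarrow> R \<ge> 0 \<and>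
     (\<forall>F. finite F \<longrightarrow> F \<subseteq> I \<longrightarrow> (\<Sum>i\<in>F. norm (u i) powr p) \<le> R powr p)"

lemma lp_bddI:
  assumes "R \<ge> 0"
    and "\<And>F. finite F \<Longrightarrow> F \<subseteq> I \<Longrightarrow> (\<Sum>i\<in>F. norm (u i) powr p) \<le> R powr p"
  shows "lp_bdd p I u R"
  using assms by (simp add: lp_bdd_def)

lemma lp_bddD:
  assumes "lp_bdd p I u R" "finite F" "F \<subseteq> I"
  shows "(\<Sum>i\<in>F. norm (u i) powr p) \<le> R powr p"
  using assms by (simp add: lp_bdd_def)

lemma lp_bdd_nonneg: "lp_bdd p I u R \<Longrightarrow> R \<ge> 0"
  by (simp add: lp_bdd_def)

lemma lp_bdd_mono:
  assumes "lp_bdd p I u R" "p > 0" "R \<le> R'" "J \<subseteq> I" "\<And>i. i \<in> J \<Longrightarrow> norm (v i) \<le> norm (u i)"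
  shows "lp_bdd p J v R'"
proof (rule lp_bddI)
  show "R' \<ge> 0" using assms(3) lp_bdd_nonneg[OF assms(1)] by simp
  fix F assume F: "finite F" "F \<subseteq> J"
  have "(\<Sum>i\<in>F. norm (v i) powr p) \<le> (\<Sum>i\<in>F. norm (u i) powr p)"
    using F assms(2,5) by (intro sum_mono powr_mono2) auto
  also have "\<dots> \<le> R powr p" using lp_bddD[OF assms(1)] F assms(4) by blast
  also have "\<dots> \<le> R' powr p"
    using assms(2,3) lp_bdd_nonneg[OF assms(1)] by (intro powr_mono2) auto
  finally show "(\<Sum>i\<in>F. norm (v i) powr p) \<le> R' powr p" .
qed

lemma lp_bdd_cong:
  assumes "\<And>i. i \<in> I \<Longrightarrow> u i = v i"
  shows "lp_bdd p I u R \<longleftrightarrow> lp_bdd p I v R"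
proof -
  have "(\<Sum>i\<in>F. norm (u i) powr p) = (\<Sum>i\<in>F. norm (v i) powr p)" if "F \<subseteq> I" for F
    using that assms by (intro sum.cong) auto
  then show ?thesis unfolding lp_bdd_def by auto
qed

lemma lp_bdd_imp_lp_set:
  assumes "lp_bdd p I u R"
  shows "lp_set p I u"
  unfolding lp_set_def
proof (rule nonneg_bdd_above_summable_on)
  show "bdd_above (sum (\<lambda>i. norm (u i) powr p) ` {F. F \<subseteq> I \<and> finite F})"
    using lp_bddD[OF assms] by (intro bdd_aboveI[of _ "R powr p"]) auto
qed simp

lemma lp_bdd_infsum_le:
  fixes u :: "'i \<Rightarrow> 'k::real_normed_field"
  assumes "lp_bdd p I u R"
  shows "(\<Sum>\<^sub>\<infinity>i\<in>I. norm (u i) powr p) \<le> R powr p"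
  using lp_bdd_imp_lp_set[OF assms] lp_bddD[OF assms]
  by (intro infsum_le_finite_sums) (auto simp: lp_set_def)

lemma lp_set_imp_lp_bdd:
  assumes "lp_set p I u" "p > 0"
  obtains R where "lp_bdd p I u R"
proof
  let ?B = "\<Sum>\<^sub>\<infinity>i\<in>I. norm (u i) powr p"
  have B: "?B \<ge> 0" by (intro infsum_nonneg) auto
  show "lp_bdd p I u (?B powr (1 / p))"
  proof (rule lp_bddI)
    fix F assume F: "finite F" "F \<subseteq> I"
    have "(\<Sum>i\<in>F. norm (u i) powr p) \<le> ?B"
      using F assms(1) by (intro finite_sum_le_infsum) (auto simp: lp_set_def)
    also have "?B = (?B powr (1 / p)) powr p"
      using B assms(2) by (simp add: powr_powr)
    finally show "(\<Sum>i\<in>F. norm (u i) powr p) \<le> (?B powr (1 / p)) powr p" .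
  qed simp
qed

lemma lp_bdd_zero: "lp_bdd p I (\<lambda>i. 0) 0"
  by (rule lp_bddI) auto

text \<open>\<open>powr_convex\<close> settles positive \<open>a\<close> and \<open>b\<close>; when
  one of them is 0, the claim reduces to \<open>s powr p \<le> s\<close> on the unit
  interval.\<close>

lemma powr_convex_comb_le:
  fixes a b t :: real
  assumes "p \<ge> 1" "0 \<le> t" "t \<le> 1" "a \<ge> 0" "b \<ge> 0"
  shows "((1 - t) * a + t * b) powr p \<le> (1 - t) * a powr p + t * b powr p"
proof -
  have scale: "(s * c) powr p \<le> s * c powr p" if "0 \<le> s" "s \<le> 1" "c \<ge> 0" for s c :: real
  proof -
    have "s powr p \<le> s powr 1" using powr_mono'[of 1 p s] that assms(1) by simp
    then have "s powr p \<le> s" using that by simp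
    then show ?thesis using that by (simp add: powr_mult mult_right_mono)
  qed
  consider "a = 0" | "b = 0" | "a > 0" "b > 0" using assms by linarith
  then show ?thesis
  proof cases
    case 1 then show ?thesis using scale[of t b] assms by simp
  next
    case 2 then show ?thesis using scale[of "1 - t" a] assms by simp
  next
    case 3
    then show ?thesis
      using convex_onD[OF powr_convex[OF assms(1)], of t a b] assms by simp
  qed
qed

text \<open>Minkowski's inequality: after division by \<open>A + B\<close>, the sum is a convex
  combination of \<open>u / A\<close> and \<open>v / B\<close>, and convexity of the power applies
  termwise.\<close>

lemma lp_bdd_add:
  assumes u: "lp_bdd p I u A" and v: "lp_bdd p I v B" and p: "p \<ge> 1"
  shows "lp_bdd p I (\<lambda>i. u i + v i) (A + B)"
proof -
  \<comment> \<open>A zero bound forces the function to vanish on \<open>I\<close>; this covers the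
    cases where division by \<open>A\<close> or \<open>B\<close> is impossible.\<close>
  have null: "w i = 0" if "lp_bdd p I w 0" "i \<in> I" for w :: "'a \<Rightarrow> 'b" and i
    using lp_bddD[OF that(1), of "{i}"] that(2) p by (simp add: powr_def split: if_splits)
  have A: "A \<ge> 0" and B: "B \<ge> 0" using u v by (auto dest: lp_bdd_nonneg)
  consider "A = 0" | "B = 0" | "A > 0" "B > 0" using A B by linarith
  then show ?thesis
  proof cases
    case 1
    then show ?thesis using v null[of u] u by (subst lp_bdd_cong[of _ _ v]) auto
  next
    case 2
    then show ?thesis using u null[of v] v by (subst lp_bdd_cong[of _ _ u]) auto
  next
    case 3
    let ?t = "B / (A + B)"
    have t: "1 - ?t = A / (A + B)" using 3 by (simp add: field_simps)
    show ?thesis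
    proof (rule lp_bddI)
      fix F assume F: "finite F" "F \<subseteq> I"
      have pw: "norm (u i + v i) powr p \<le> (A + B) powr p *
          (A / (A + B) * (norm (u i) powr p / A powr p) + ?t * (norm (v i) powr p / B powr p))"
        for i
      proof -
        have "norm (u i + v i) powr p \<le> (norm (u i) + norm (v i)) powr p"
          using p by (intro powr_mono2) (auto intro: norm_triangle_ineq)
        also have "norm (u i) + norm (v i) =
            (A + B) * ((1 - ?t) * (norm (u i) / A) + ?t * (norm (v i) / B))"
          unfolding t distrib_left mult.assoc[symmetric] using 3 by simp
        also have "\<dots> powr p = (A + B) powr p * ((1 - ?t) * (norm (u i) / A) + ?t * (norm (v i) / B)) powr p"
          using 3 unfolding t by (subst powr_mult) auto
        also have "\<dots> \<le> (A + B) powr p * ((1 - ?t) * (norm (u i) / A) powr p + ?t * (norm (v i) / B) powr p)"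
          using 3 p by (intro mult_left_mono powr_convex_comb_le) auto
        finally show ?thesis
          unfolding t using 3 by (simp add: powr_divide)
      qed
      have "(\<Sum>i\<in>F. norm (u i + v i) powr p) \<le> (\<Sum>i\<in>F. (A + B) powr p *
          (A / (A + B) * (norm (u i) powr p / A powr p) + ?t * (norm (v i) powr p / B powr p)))"
        by (intro sum_mono pw)
      also have "\<dots> = (A + B) powr p * (A / (A + B) * ((\<Sum>i\<in>F. norm (u i) powr p) / A powr p)
          + ?t * ((\<Sum>i\<in>F. norm (v i) powr p) / B powr p))"
        by (simp only: sum_distrib_left[symmetric] sum.distrib sum_divide_distrib[symmetric])
      also have "\<dots> \<le> (A + B) powr p * (A / (A + B) * 1 + ?t * 1)"
        using 3 lp_bddD[OF u F] lp_bddD[OF v F]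
        by (intro mult_left_mono add_mono) (auto simp: divide_le_eq)
      also have "\<dots> = (A + B) powr p" using 3 by (simp add: add_divide_distrib[symmetric])
      finally show "(\<Sum>i\<in>F. norm (u i + v i) powr p) \<le> (A + B) powr p" .
    qed (use A B in simp)
  qed
qed

lemma lp_bdd_scaleR:
  assumes "lp_bdd p I u R"
  shows "lp_bdd p I (\<lambda>i. c *\<^sub>R u i) (\<bar>c\<bar> * R)"
proof (rule lp_bddI)
  show "\<bar>c\<bar> * R \<ge> 0" using lp_bdd_nonneg[OF assms] by simp
  fix F assume F: "finite F" "F \<subseteq> I"
  have "(\<Sum>i\<in>F. norm (c *\<^sub>R u i) powr p) = \<bar>c\<bar> powr p * (\<Sum>i\<in>F. norm (u i) powr p)"
    by (simp add: powr_mult sum_distrib_left)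
  also have "\<dots> \<le> \<bar>c\<bar> powr p * R powr p"
    using lp_bddD[OF assms F] by (intro mult_left_mono) auto
  finally show "(\<Sum>i\<in>F. norm (c *\<^sub>R u i) powr p) \<le> (\<bar>c\<bar> * R) powr p"
    using lp_bdd_nonneg[OF assms] by (simp add: powr_mult)
qed

lemma lp_bdd_minus: "lp_bdd p I u R \<Longrightarrow> lp_bdd p I (\<lambda>i. - u i) R"
  using lp_bdd_scaleR[of p I u R "-1"] by simp

lemma lp_bdd_sum:
  assumes "\<And>j. j \<in> J \<Longrightarrow> lp_bdd p I (u j) (R j)" "p \<ge> 1"
  shows "lp_bdd p I (\<lambda>i. \<Sum>j\<in>J. u j i) (\<Sum>j\<in>J. R j)"
  using assms
proof (induction J rule: infinite_finite_induct)
  case (insert x F)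
  then show ?case using lp_bdd_add[of p I "u x" "R x" "\<lambda>i. \<Sum>j\<in>F. u j i" "sum R F"] by simp
qed (auto intro: lp_bdd_zero)

text \<open>Makes translations, and the passage between edges and vertices, free of cost in the
  norm.\<close>

lemma lp_bdd_reindex:
  assumes "lp_bdd p I u R" "inj_on h J" "h ` J \<subseteq> I"
  shows "lp_bdd p J (\<lambda>j. u (h j)) R"
proof (rule lp_bddI)
  fix F assume F: "finite F" "F \<subseteq> J"
  have "(\<Sum>j\<in>F. norm (u (h j)) powr p) = (\<Sum>i\<in>h ` F. norm (u i) powr p)"
    using F assms(2) by (subst sum.reindex) (auto intro: inj_on_subset)
  also have "\<dots> \<le> R powr p" using F assms(3) by (intro lp_bddD[OF assms(1)]) auto
  finally show "(\<Sum>j\<in>F. norm (u (h j)) powr p) \<le> R powr p" .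
qed (rule lp_bdd_nonneg[OF assms(1)])

lemma sum_UN_le:
  fixes f :: "'i \<Rightarrow> real"
  assumes "finite S" "\<And>s. s \<in> S \<Longrightarrow> finite (A s)" "\<And>i. f i \<ge> 0"
  shows "(\<Sum>i\<in>(\<Union>s\<in>S. A s). f i) \<le> (\<Sum>s\<in>S. \<Sum>i\<in>A s. f i)"
  using assms(1,2)
proof (induction S rule: finite_induct)
  case (insert s S)
  have "sum f (A s \<union> \<Union> (A ` S)) \<le> sum f (A s) + sum f (\<Union> (A ` S))"
    using insert.hyps insert.prems sum_nonneg[of "A s \<inter> \<Union> (A ` S)" f] assms(3)
    by (subst sum_Un) auto
  also have "sum f (\<Union> (A ` S)) \<le> (\<Sum>s\<in>S. \<Sum>i\<in>A s. f i)"
    using insert by simp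
  finally show ?case using insert.hyps by simp
qed simp

text \<open>The pieces may overlap, in which case the right-hand side counts elements repeatedly.
  Used to glue the edge sets of the individual generators.\<close>

lemma lp_bdd_UN:
  assumes "finite S" "\<And>s. s \<in> S \<Longrightarrow> lp_bdd p (I s) u (R s)" "p > 0"
  shows "lp_bdd p (\<Union>s\<in>S. I s) u ((\<Sum>s\<in>S. R s powr p) powr (1 / p))"
proof (rule lp_bddI)
  fix F assume F: "finite F" "F \<subseteq> (\<Union>s\<in>S. I s)"
  have "(\<Sum>i\<in>F. norm (u i) powr p) \<le> (\<Sum>i\<in>(\<Union>s\<in>S. F \<inter> I s). norm (u i) powr p)"
    using F assms(1) by (intro sum_mono2) auto
  also have "\<dots> \<le> (\<Sum>s\<in>S. \<Sum>i\<in>F \<inter> I s. norm (u i) powr p)"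
    using F assms(1) by (intro sum_UN_le) auto
  also have "\<dots> \<le> (\<Sum>s\<in>S. R s powr p)"
    using F lp_bddD[OF assms(2)] by (intro sum_mono) auto
  also have "\<dots> = ((\<Sum>s\<in>S. R s powr p) powr (1 / p)) powr p"
    using assms(3) by (simp add: powr_powr sum_nonneg)
  finally show "(\<Sum>i\<in>F. norm (u i) powr p) \<le> ((\<Sum>s\<in>S. R s powr p) powr (1 / p)) powr p" .
qed simp

section \<open>Tails and pointwise null sequences in l^p\<close>

text \<open>If \<open>A\<close> nearly attains the supremum of the partial sums, a finite set
  disjoint from \<open>A\<close> can add at most \<open>\<delta> powr p\<close>.\<close>

lemma lp_bdd_tail:
  assumes "lp_bdd p I u R" "\<delta> > 0"
  obtains A where "finite A" "A \<subseteq> I" "lp_bdd p (I - A) u \<delta>"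
proof -
  let ?s = "\<lambda>F. \<Sum>i\<in>F. norm (u i) powr p"
  let ?X = "?s ` {F. finite F \<and> F \<subseteq> I}"
  have bdd: "bdd_above ?X" using lp_bddD[OF assms(1)] by (intro bdd_aboveI[of _ "R powr p"]) auto
  have "Sup ?X - \<delta> powr p < Sup ?X" using assms(2) by simp
  moreover have "?X \<noteq> {}" by auto
  ultimately obtain A where A: "finite A" "A \<subseteq> I" "Sup ?X - \<delta> powr p < ?s A"
    using less_cSup_iff[OF _ bdd, of "Sup ?X - \<delta> powr p"] by auto
  have "lp_bdd p (I - A) u \<delta>"
  proof (rule lp_bddI)
    fix F assume F: "finite F" "F \<subseteq> I - A"
    have "?s (F \<union> A) \<le> Sup ?X" using F A bdd by (intro cSup_upper) auto
    moreover have "?s (F \<union> A) = ?s F + ?s A" using F A by (intro sum.union_disjoint) auto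
    ultimately show "?s F \<le> \<delta> powr p" using A(3) by simp
  qed (use assms(2) in simp)
  then show ?thesis using A that by blast
qed

text \<open>A Brezis--Lieb type estimate: a pointwise null sequence is eventually almost disjoint from any
  fixed \<open>w\<close>, so that \<open>p\<close>-th powers of norms almost add up.\<close>
lemma lp_bdd_add_null_sequence:
  fixes u :: "nat \<Rightarrow> 'i \<Rightarrow> 'k::real_normed_vector"
  assumes w: "lp_bdd p I w W" and u: "\<And>n. lp_bdd p I (u n) M"
    and lim: "\<And>i. i \<in> I \<Longrightarrow> (\<lambda>n. u n i) \<longlonglongrightarrow> 0" and p: "p \<ge> 1"
  shows "\<exists>n. lp_bdd p I (\<lambda>i. w i + u n i) ((W powr p + M powr p + 1) powr (1 / p))"
proof -
  have W: "W \<ge> 0" and M: "M \<ge> 0" using w u by (auto dest: lp_bdd_nonneg)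
  have *: "((\<lambda>\<delta>. (c + \<delta>) powr p) \<longlongrightarrow> (c + 0) powr p) (at_right 0)" if "c \<ge> 0" for c
  proof (rule tendsto_powr')
    have "\<forall>\<^sub>F \<delta> in at_right 0. c + \<delta> \<ge> 0"
      using that by (intro eventually_at_rightI[of 0 1]) auto
    then show "c + 0 \<noteq> 0 \<or> 0 < p \<and> (\<forall>\<^sub>F \<delta> in at_right 0. c + \<delta> \<ge> 0)"
      using p by simp
  qed (intro tendsto_add tendsto_const tendsto_ident_at)+
  have "((\<lambda>\<delta>. (W + \<delta>) powr p + (\<delta> + M) powr p) \<longlongrightarrow> W powr p + M powr p) (at_right 0)"
    using tendsto_add[OF *[OF W] *[OF M]] by (simp add: add.commute)
  then have "\<forall>\<^sub>F \<delta> in at_right 0. (W + \<delta>) powr p + (\<delta> + M) powr p < W powr p + M powr p + 1"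
    by (rule order_tendstoD) simp
  then obtain b where b: "b > 0"
      "\<And>\<delta>. 0 < \<delta> \<Longrightarrow> \<delta> < b \<Longrightarrow> (W + \<delta>) powr p + (\<delta> + M) powr p < W powr p + M powr p + 1"
    unfolding eventually_at_right_field by auto
  \<comment> \<open>At this \<open>\<delta>\<close> the cross terms cost less than 1 in total, which
    is the summand 1 in the bound.\<close>
  define \<delta> where "\<delta> = b / 2"
  have \<delta>: "\<delta> > 0" "(W + \<delta>) powr p + (\<delta> + M) powr p < W powr p + M powr p + 1"
    using b by (auto simp: \<delta>_def)
  obtain A where A: "finite A" "A \<subseteq> I" "lp_bdd p (I - A) w \<delta>"
    using lp_bdd_tail[OF w \<delta>(1)] .
  \<comment> \<open>On the finite set \<open>A\<close> pointwise convergence is norm convergence, so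
    some \<open>u n\<close> is negligible there, while \<open>w\<close> is negligible off
    \<open>A\<close>.\<close>
  have "(\<lambda>n. \<Sum>i\<in>A. norm (u n i) powr p) \<longlonglongrightarrow> (\<Sum>i\<in>A. 0 powr p)"
    using A(2) lim p by (intro tendsto_sum tendsto_powr' tendsto_norm_zero tendsto_const) auto
  then have "\<forall>\<^sub>F n in sequentially. (\<Sum>i\<in>A. norm (u n i) powr p) < \<delta> powr p"
    using \<delta>(1) by (intro order_tendstoD(2)[where y = 0 and a = "\<delta> powr p"]) auto
  then obtain n where n: "(\<Sum>i\<in>A. norm (u n i) powr p) < \<delta> powr p"
    by (auto simp: eventually_sequentially)
  have uA: "lp_bdd p A (u n) \<delta>"
  proof (rule lp_bddI)
    fix F assume F: "finite F" "F \<subseteq> A"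
    have "(\<Sum>i\<in>F. norm (u n i) powr p) \<le> (\<Sum>i\<in>A. norm (u n i) powr p)"
      using F A by (intro sum_mono2) auto
    then show "(\<Sum>i\<in>F. norm (u n i) powr p) \<le> \<delta> powr p" using n by simp
  qed (use \<delta> in simp)
  have on: "lp_bdd p A (\<lambda>i. w i + u n i) (W + \<delta>)"
    using lp_bdd_add[OF lp_bdd_mono[OF w] uA p] A p by auto
  have off: "lp_bdd p (I - A) (\<lambda>i. w i + u n i) (\<delta> + M)"
    using lp_bdd_add[OF A(3) lp_bdd_mono[OF u] p] p by auto
  have "lp_bdd p I (\<lambda>i. w i + u n i) ((W powr p + M powr p + 1) powr (1 / p))"
  proof (rule lp_bddI)
    fix F assume F: "finite F" "F \<subseteq> I"
    have "(\<Sum>i\<in>F. norm (w i + u n i) powr p) =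
        (\<Sum>i\<in>F \<inter> A. norm (w i + u n i) powr p) + (\<Sum>i\<in>F - A. norm (w i + u n i) powr p)"
      using F(1) by (rule sum.Int_Diff)
    also have "\<dots> \<le> (W + \<delta>) powr p + (\<delta> + M) powr p"
      using F by (intro add_mono lp_bddD[OF on] lp_bddD[OF off]) auto
    also have "\<dots> \<le> ((W powr p + M powr p + 1) powr (1 / p)) powr p"
      using \<delta>(2) p by (simp add: powr_powr)
    finally show "(\<Sum>i\<in>F. norm (w i + u n i) powr p)
        \<le> ((W powr p + M powr p + 1) powr (1 / p)) powr p" .
  qed simp
  then show ?thesis ..
qed

text \<open>Greedy selection: each new term is chosen after the sum built so far, so that the
  \<open>p\<close>-th power of the bound grows by only \<open>M powr p + 1\<close>.\<close>

lemma lp_bdd_sum_null_sequence: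
  fixes u :: "nat \<Rightarrow> 'i \<Rightarrow> 'k::real_normed_vector"
  assumes u: "\<And>n. lp_bdd p I (u n) M"
    and lim: "\<And>i. i \<in> I \<Longrightarrow> (\<lambda>n. u n i) \<longlonglongrightarrow> 0" and p: "p \<ge> 1"
  shows "\<exists>\<nu>. lp_bdd p I (\<lambda>i. \<Sum>k<N. u (\<nu> k) i) ((real N * (M powr p + 1)) powr (1 / p))"
proof (induction N)
  case 0
  then show ?case using lp_bdd_zero by auto
next
  case (Suc N)
  let ?W = "(real N * (M powr p + 1)) powr (1 / p)"
  obtain \<nu> where \<nu>: "lp_bdd p I (\<lambda>i. \<Sum>k<N. u (\<nu> k) i) ?W" using Suc.IH by blast
  obtain n where n: "lp_bdd p I (\<lambda>i. (\<Sum>k<N. u (\<nu> k) i) + u n i) ((?W powr p + M powr p + 1) powr (1 / p))"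
    using lp_bdd_add_null_sequence[OF \<nu> u lim p] by blast
  have "?W powr p + M powr p + 1 = real (Suc N) * (M powr p + 1)"
    using p by (simp add: powr_powr algebra_simps)
  moreover have "(\<Sum>k<Suc N. u ((\<nu>(N := n)) k) i) = (\<Sum>k<N. u (\<nu> k) i) + u n i" for i
    by simp
  ultimately show ?case using n by (intro exI[of _ "\<nu>(N := n)"]) simp
qed

text \<open>Weak convergence is upgraded to norm convergence of averages here, without any appeal to
  reflexivity or Mazur's lemma: the sum of \<open>N\<close> terms has norm \<open>O(N powr (1 / p))\<close>, which is \<open>o(N)\<close>.\<close>
lemma lp_bdd_average_null_sequence:
  fixes u :: "nat \<Rightarrow> 'i \<Rightarrow> 'k::real_normed_vector"
  assumes u: "\<And>n. lp_bdd p I (u n) M"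
    and lim: "\<And>i. i \<in> I \<Longrightarrow> (\<lambda>n. u n i) \<longlonglongrightarrow> 0" and p: "p > 1" and \<epsilon>: "\<epsilon> > 0"
  obtains N \<nu> where "N > 0" "lp_bdd p I (\<lambda>i. (1 / real N) *\<^sub>R (\<Sum>k<N. u (\<nu> k) i)) \<epsilon>"
proof -
  define c where "c = (M powr p + 1) powr (1 / p)"
  \<comment> \<open>Here \<open>p > 1\<close> is essential: it makes the exponent
    \<open>1 / p - 1\<close> negative.\<close>
  have "(\<lambda>N. c * real N powr (1 / p - 1)) \<longlonglongrightarrow> c * 0"
    using p by (intro tendsto_intros tendsto_neg_powr filterlim_real_sequentially) auto
  then have "\<forall>\<^sub>F N in sequentially. c * real N powr (1 / p - 1) < \<epsilon>"
    using \<epsilon> by (intro order_tendstoD(2)[where y = 0]) auto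
  then have "\<forall>\<^sub>F N in sequentially. N > 0 \<and> c * real N powr (1 / p - 1) < \<epsilon>"
    using eventually_gt_at_top[of 0] by eventually_elim auto
  then obtain N where N: "N > 0" "c * real N powr (1 / p - 1) < \<epsilon>"
    by (auto simp: eventually_sequentially)
  obtain \<nu> where "lp_bdd p I (\<lambda>i. \<Sum>k<N. u (\<nu> k) i) ((real N * (M powr p + 1)) powr (1 / p))"
    using lp_bdd_sum_null_sequence[OF u lim, of N] p by auto
  from lp_bdd_scaleR[OF this, of "1 / real N"]
  have "lp_bdd p I (\<lambda>i. (1 / real N) *\<^sub>R (\<Sum>k<N. u (\<nu> k) i))
      (1 / real N * (real N * (M powr p + 1)) powr (1 / p))" by simp
  moreover have "1 / real N * (real N * (M powr p + 1)) powr (1 / p) = c * real N powr (1 / p - 1)"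
    using N(1) by (simp add: c_def powr_mult powr_diff)
  ultimately have "lp_bdd p I (\<lambda>i. (1 / real N) *\<^sub>R (\<Sum>k<N. u (\<nu> k) i)) \<epsilon>"
    using N(2) p by (intro lp_bdd_mono[of p I _ _ \<epsilon>]) auto
  then show ?thesis using N(1) that by blast
qed

lemma infsum_eq_sum_superset:
  fixes f :: "'i \<Rightarrow> 'c::{comm_monoid_add, t2_space}"
  assumes "finite F" "F \<subseteq> I" "\<And>i. i \<in> I - F \<Longrightarrow> f i = 0"
  shows "infsum f I = sum f F"
  using assms infsum_cong_neutral[of F I f f] by (metis DiffD1 DiffD2 infsum_finite subsetD)

section \<open>Walks in the Cayley graph and differences of translates\<close>

context group
begin

lemma cay_walk_append: "cay_walk G x (ws @ vs) = cay_walk G (cay_walk G x ws) vs"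
  by (induction ws arbitrary: x) auto

lemma cay_walk_generate:
  assumes "S \<subseteq> carrier G" "\<And>s. s \<in> S \<Longrightarrow> inv s \<in> S" "h \<in> generate G S"
  shows "\<exists>ws. set ws \<subseteq> S \<and> (\<forall>x\<in>carrier G. cay_walk G x ws = h \<otimes> x)"
  using assms(3)
proof induction
  case one
  show ?case by (rule exI[of _ "[]"]) simp
next
  case (incl h)
  \<comment> \<open>A step along \<open>s\<close> multiplies by \<open>inv s\<close>, so
    \<open>h\<close> is realized by the letter \<open>inv h\<close>.\<close>
  then show ?case using assms(1,2) by (intro exI[of _ "[inv h]"]) (auto simp: subset_iff)
next
  case (inv h)
  then show ?case by (intro exI[of _ "[h]"]) auto
next
  case (eng h1 h2)
  then obtain ws vs where
    "set ws \<subseteq> S" "\<forall>x\<in>carrier G. cay_walk G x ws = h1 \<otimes> x"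
    "set vs \<subseteq> S" "\<forall>x\<in>carrier G. cay_walk G x vs = h2 \<otimes> x" by blast
  moreover have "h1 \<in> carrier G" "h2 \<in> carrier G"
    using eng.hyps generate_in_carrier[OF assms(1)] by auto
  ultimately show ?case
    \<comment> \<open>Steps multiply on the left, so the word of the right factor \<open>h2\<close>
      is walked first.\<close>
    by (intro exI[of _ "vs @ ws"]) (auto simp: cay_walk_append m_assoc)
qed

text \<open>Since \<open>S\<close> generates, the set under \<open>LEAST\<close> is nonempty, and
  the distance is realized by an actual walk.\<close>

lemma cay_dist_walk:
  assumes "fin_sym_gen_set G S" "x \<in> carrier G" "y \<in> carrier G"
  obtains ws where "length ws = cay_dist G S x y" "set ws \<subseteq> S" "cay_walk G x ws = y"
proof -
  have "y \<otimes> inv x \<in> generate G S" using assms by (simp add: fin_sym_gen_set_def)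
  then obtain ws where "set ws \<subseteq> S" "cay_walk G x ws = (y \<otimes> inv x) \<otimes> x"
    using cay_walk_generate[of S "y \<otimes> inv x"] assms by (auto simp: fin_sym_gen_set_def)
  then have "\<exists>n ws. length ws = n \<and> set ws \<subseteq> S \<and> cay_walk G x ws = y"
    using assms by (auto simp: m_assoc)
  from LeastI_ex[OF this] show ?thesis
    using that unfolding cay_dist_def by blast
qed

lemma cay_edges_eq_UN: "cay_edges G S = (\<Union>s\<in>S. (\<lambda>x. (x, inv s \<otimes> x)) ` carrier G)"
  by (auto simp: cay_edges_def)

text \<open>For a fixed generator the edges are parametrized injectively by their first vertex, so
  gradient bounds and bounds on the derivatives \<open>left_reg G s f - f\<close> are
  interchangeable up to constants.\<close>

lemma lp_bdd_gradD:
  assumes "lp_bdd p (cay_edges G S) (grad f) R" "s \<in> S"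
  shows "lp_bdd p (carrier G) (\<lambda>x. left_reg G s f x - f x) R"
proof -
  have "lp_bdd p (carrier G) (\<lambda>x. grad f (x, inv s \<otimes> x)) R"
    using assms by (intro lp_bdd_reindex[OF assms(1)]) (auto simp: cay_edges_def inj_on_def)
  then show ?thesis by (simp add: grad_def left_reg_def)
qed

lemma lp_bdd_gradI:
  assumes "finite S" "\<And>s. s \<in> S \<Longrightarrow> lp_bdd p (carrier G) (\<lambda>x. left_reg G s f x - f x) (R s)" "p > 0"
  shows "lp_bdd p (cay_edges G S) (grad f) ((\<Sum>s\<in>S. R s powr p) powr (1 / p))"
  unfolding cay_edges_eq_UN
proof (rule lp_bdd_UN[OF assms(1) _ assms(3)])
  fix s assume s: "s \<in> S"
  let ?I = "(\<lambda>x. (x, inv s \<otimes> x)) ` carrier G"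
  have "lp_bdd p ?I (\<lambda>e. left_reg G s f (fst e) - f (fst e)) (R s)"
    by (rule lp_bdd_reindex[OF assms(2)[OF s]]) (auto simp: inj_on_def)
  then show "lp_bdd p ?I (grad f) (R s)"
    by (subst lp_bdd_cong[of _ _ "\<lambda>e. left_reg G s f (fst e) - f (fst e)"])
      (auto simp: grad_def left_reg_def)
qed

text \<open>Telescoping: each step contributes the derivative along one letter at the point
  \<open>y \<otimes> x\<close>, and replacing \<open>x\<close> by \<open>y \<otimes> x\<close> does
  not increase the norm.\<close>

lemma lp_bdd_walk:
  assumes "\<And>t. t \<in> S \<Longrightarrow> lp_bdd p (carrier G) (\<lambda>x. left_reg G t f x - f x) M"
    and "S \<subseteq> carrier G" "set ws \<subseteq> S" "y \<in> carrier G" "p \<ge> 1"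
  shows "lp_bdd p (carrier G) (\<lambda>x. f (cay_walk G y ws \<otimes> x) - f (y \<otimes> x)) (real (length ws) * M)"
  using assms(3,4)
proof (induction ws arbitrary: y)
  case Nil
  then show ?case using lp_bdd_zero by simp
next
  case (Cons t ws)
  let ?y = "inv t \<otimes> y"
  have t: "t \<in> S" "t \<in> carrier G" using Cons.prems assms(2) by auto
  have "lp_bdd p (carrier G) (\<lambda>x. left_reg G t f (y \<otimes> x) - f (y \<otimes> x)) M"
    using Cons.prems by (intro lp_bdd_reindex[OF assms(1)[OF t(1)]]) (auto simp: inj_on_def)
  moreover have "lp_bdd p (carrier G) (\<lambda>x. f (cay_walk G ?y ws \<otimes> x) - f (?y \<otimes> x)) (real (length ws) * M)"
    using Cons t by auto
  ultimately have "lp_bdd p (carrier G) (\<lambda>x. (f (cay_walk G ?y ws \<otimes> x) - f (?y \<otimes> x))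
      + (left_reg G t f (y \<otimes> x) - f (y \<otimes> x))) (real (length ws) * M + M)"
    using assms(5) by (intro lp_bdd_add) auto
  then show ?case
    using t Cons.prems
    by (subst (asm) lp_bdd_cong[of _ _ "\<lambda>x. f (cay_walk G y (t # ws) \<otimes> x) - f (y \<otimes> x)"])
      (auto simp: left_reg_def m_assoc algebra_simps)
qed

lemma lp_bdd_cay_dist:
  assumes "\<And>t. t \<in> S \<Longrightarrow> lp_bdd p (carrier G) (\<lambda>x. left_reg G t f x - f x) M"
    and "fin_sym_gen_set G S" "y \<in> carrier G" "z \<in> carrier G" "p \<ge> 1"
  shows "lp_bdd p (carrier G) (\<lambda>x. f (y \<otimes> x) - f (z \<otimes> x)) (real (cay_dist G S y z) * M)"
proof -
  obtain ws where ws: "length ws = cay_dist G S y z" "set ws \<subseteq> S" "cay_walk G y ws = z"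
    using cay_dist_walk[OF assms(2-4)] .
  have "lp_bdd p (carrier G) (\<lambda>x. f (cay_walk G y ws \<otimes> x) - f (y \<otimes> x)) (real (length ws) * M)"
    using assms ws by (intro lp_bdd_walk[where S = S]) (auto simp: fin_sym_gen_set_def)
  from lp_bdd_minus[OF this] show ?thesis unfolding ws by simp
qed

text \<open>Controls the derivative along any group element by those along \<open>S\<close>; this is
  what permits a change of generating set.\<close>

lemma lp_bdd_left_reg:
  assumes "\<And>t. t \<in> S \<Longrightarrow> lp_bdd p (carrier G) (\<lambda>x. left_reg G t f x - f x) M"
    and "fin_sym_gen_set G S" "\<gamma> \<in> carrier G" "p \<ge> 1"
  shows "lp_bdd p (carrier G) (\<lambda>x. left_reg G \<gamma> f x - f x) (real (cay_dist G S (inv \<gamma>) \<one>) * M)"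
proof -
  have "lp_bdd p (carrier G) (\<lambda>x. f (inv \<gamma> \<otimes> x) - f (\<one> \<otimes> x)) (real (cay_dist G S (inv \<gamma>) \<one>) * M)"
    using assms by (intro lp_bdd_cay_dist) auto
  then show ?thesis
    by (subst (asm) lp_bdd_cong[of _ _ "\<lambda>x. left_reg G \<gamma> f x - f x"]) (auto simp: left_reg_def)
qed

section \<open>Couplings and transport cost\<close>

text \<open>Writing both weights as marginals of \<open>m\<close> merges the two integrals into one
  against the plan, which distances then control term by term.\<close>

lemma couplings_infsum_diff:
  fixes a :: "'a \<Rightarrow> 'k::real_normed_vector"
  assumes "m \<in> couplings G \<xi> \<phi>"
  shows "(\<Sum>\<^sub>\<infinity>y\<in>carrier G. \<xi> y *\<^sub>R a y) - (\<Sum>\<^sub>\<infinity>y\<in>carrier G. \<phi> y *\<^sub>R a y)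
    = (\<Sum>z\<in>{z. m z \<noteq> 0}. m z *\<^sub>R (a (fst z) - a (snd z)))"
proof -
  let ?P = "{z. m z \<noteq> 0}"
  \<comment> \<open>Containing both projections of the support, \<open>A\<close> serves as summation
    range for both marginals.\<close>
  define A where "A = fst ` ?P \<union> snd ` ?P"
  have P: "finite ?P" "?P \<subseteq> carrier G \<times> carrier G"
    and \<xi>: "\<And>x. x \<in> carrier G \<Longrightarrow> (\<Sum>\<^sub>\<infinity>y\<in>carrier G. m (x, y)) = \<xi> x"
    and \<phi>: "\<And>y. y \<in> carrier G \<Longrightarrow> (\<Sum>\<^sub>\<infinity>x\<in>carrier G. m (x, y)) = \<phi> y"
    using assms by (auto simp: couplings_def)
  have A: "finite A" "A \<subseteq> carrier G" using P by (auto simp: A_def)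
  have PA: "?P \<subseteq> A \<times> A" by (force simp: A_def)
  then have m0: "m (x, y) = 0" if "x \<notin> A \<or> y \<notin> A" for x y using that by auto
  have \<xi>': "\<xi> x = (\<Sum>y\<in>A. m (x, y))" if "x \<in> carrier G" for x
    unfolding \<xi>[OF that, symmetric] using A m0 by (intro infsum_eq_sum_superset) auto
  have \<phi>': "\<phi> y = (\<Sum>x\<in>A. m (x, y))" if "y \<in> carrier G" for y
    unfolding \<phi>[OF that, symmetric] using A m0 by (intro infsum_eq_sum_superset) auto
  have supp: "(\<Sum>z\<in>A \<times> A. m z *\<^sub>R b z) = (\<Sum>z\<in>?P. m z *\<^sub>R b z)" for b :: "'a \<times> 'a \<Rightarrow> 'k"
    using A PA by (intro sum.mono_neutral_right) auto
  have "(\<Sum>\<^sub>\<infinity>y\<in>carrier G. \<xi> y *\<^sub>R a y) = (\<Sum>x\<in>A. \<xi> x *\<^sub>R a x)"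
    using A m0 by (intro infsum_eq_sum_superset) (auto simp: \<xi>')
  also have "\<dots> = (\<Sum>x\<in>A. \<Sum>y\<in>A. m (x, y) *\<^sub>R a x)"
    using A by (intro sum.cong) (auto simp: \<xi>' scaleR_sum_left)
  also have "\<dots> = (\<Sum>z\<in>A \<times> A. m z *\<^sub>R a (fst z))"
    by (simp add: sum.cartesian_product case_prod_unfold)
  finally have 1: "(\<Sum>\<^sub>\<infinity>y\<in>carrier G. \<xi> y *\<^sub>R a y) = (\<Sum>z\<in>?P. m z *\<^sub>R a (fst z))"
    by (simp only: supp)
  have "(\<Sum>\<^sub>\<infinity>y\<in>carrier G. \<phi> y *\<^sub>R a y) = (\<Sum>y\<in>A. \<phi> y *\<^sub>R a y)"
    using A m0 by (intro infsum_eq_sum_superset) (auto simp: \<phi>')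
  also have "\<dots> = (\<Sum>y\<in>A. \<Sum>x\<in>A. m (x, y) *\<^sub>R a y)"
    using A by (intro sum.cong) (auto simp: \<phi>' scaleR_sum_left)
  also have "\<dots> = (\<Sum>x\<in>A. \<Sum>y\<in>A. m (x, y) *\<^sub>R a y)"
    by (rule sum.swap)
  also have "\<dots> = (\<Sum>z\<in>A \<times> A. m z *\<^sub>R a (snd z))"
    by (simp add: sum.cartesian_product case_prod_unfold)
  finally have 2: "(\<Sum>\<^sub>\<infinity>y\<in>carrier G. \<phi> y *\<^sub>R a y) = (\<Sum>z\<in>?P. m z *\<^sub>R a (snd z))"
    by (simp only: supp)
  show ?thesis unfolding 1 2 by (simp add: sum_subtractf scaleR_diff_right)
qed

text \<open>The product measure is a coupling. This is needed because \<open>trc\<close> is a real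
  \<open>Inf\<close>, which is informative only for a nonempty set.\<close>

lemma couplings_nonempty:
  assumes "finite {x \<in> carrier G. \<xi> x \<noteq> 0}" "\<And>x. x \<in> carrier G \<Longrightarrow> \<xi> x \<ge> 0" "(\<Sum>\<^sub>\<infinity>x\<in>carrier G. \<xi> x) = 1"
    and "finite {x \<in> carrier G. \<phi> x \<noteq> 0}" "\<And>x. x \<in> carrier G \<Longrightarrow> \<phi> x \<ge> 0" "(\<Sum>\<^sub>\<infinity>x\<in>carrier G. \<phi> x) = 1"
  shows "couplings G \<xi> \<phi> \<noteq> {}"
proof -
  \<comment> \<open>The cut-off matters because \<open>\<xi>\<close> and \<open>\<phi>\<close> are
    controlled on the carrier only.\<close>
  define m where "m = (\<lambda>(x, y). if x \<in> carrier G \<and> y \<in> carrier G then \<xi> x * \<phi> y else 0)"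
  have "{z. m z \<noteq> 0} \<subseteq> {x \<in> carrier G. \<xi> x \<noteq> 0} \<times> {x \<in> carrier G. \<phi> x \<noteq> 0}"
    by (auto simp: m_def split: if_splits)
  then have "finite {z. m z \<noteq> 0}" "{z. m z \<noteq> 0} \<subseteq> carrier G \<times> carrier G"
    using assms(1,4) finite_subset by blast+
  moreover have "m z \<ge> 0" for z using assms(2,5) by (auto simp: m_def split: prod.split)
  moreover have "(\<Sum>\<^sub>\<infinity>y\<in>carrier G. m (x, y)) = \<xi> x" if "x \<in> carrier G" for x
  proof -
    have "(\<Sum>\<^sub>\<infinity>y\<in>carrier G. m (x, y)) = (\<Sum>\<^sub>\<infinity>y\<in>carrier G. \<xi> x * \<phi> y)"
      using that by (intro infsum_cong) (auto simp: m_def)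
    then show ?thesis using assms(6) by (simp add: infsum_cmult_right')
  qed
  moreover have "(\<Sum>\<^sub>\<infinity>x\<in>carrier G. m (x, y)) = \<phi> y" if "y \<in> carrier G" for y
  proof -
    have "(\<Sum>\<^sub>\<infinity>x\<in>carrier G. m (x, y)) = (\<Sum>\<^sub>\<infinity>x\<in>carrier G. \<xi> x * \<phi> y)"
      using that by (intro infsum_cong) (auto simp: m_def)
    then show ?thesis using assms(3) by (simp add: infsum_cmult_left')
  qed
  ultimately have "m \<in> couplings G \<xi> \<phi>" by (simp add: couplings_def)
  then show ?thesis by blast
qed

lemma bij_betw_mult_left: "s \<in> carrier G \<Longrightarrow> bij_betw (\<lambda>x. s \<otimes> x) (carrier G) (carrier G)"
  by (rule bij_betw_byWitness[of _ "\<lambda>x. inv s \<otimes> x"]) (auto simp: m_assoc[symmetric])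

lemma bij_betw_mult_right: "s \<in> carrier G \<Longrightarrow> bij_betw (\<lambda>x. x \<otimes> s) (carrier G) (carrier G)"
  by (rule bij_betw_byWitness[of _ "\<lambda>x. x \<otimes> inv s"]) (auto simp: m_assoc)

lemma bij_betw_inv: "bij_betw (\<lambda>x. inv x) (carrier G) (carrier G)"
  by (rule bij_betw_byWitness[of _ "\<lambda>x. inv x"]) auto

lemma fs_prob_infsum:
  fixes a :: "'a \<Rightarrow> 'k::real_normed_vector"
  assumes "fs_prob G \<xi>"
  shows "(\<Sum>\<^sub>\<infinity>x\<in>carrier G. \<xi> x *\<^sub>R a x) = (\<Sum>x\<in>{x. \<xi> x \<noteq> 0}. \<xi> x *\<^sub>R a x)"
  using assms by (intro infsum_eq_sum_superset) (auto simp: fs_prob_def)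

text \<open>Restricted to the carrier, since nothing is known about \<open>h\<close> outside
  it.\<close>

lemma fs_prob_pullback:
  assumes "fs_prob G \<xi>" "bij_betw h (carrier G) (carrier G)"
  shows "finite {x \<in> carrier G. \<xi> (h x) \<noteq> 0}" "(\<Sum>\<^sub>\<infinity>x\<in>carrier G. \<xi> (h x)) = 1"
proof -
  have "h ` {x \<in> carrier G. \<xi> (h x) \<noteq> 0} \<subseteq> {x. \<xi> x \<noteq> 0}" by auto
  then have "finite (h ` {x \<in> carrier G. \<xi> (h x) \<noteq> 0})"
    using assms(1) finite_subset by (auto simp: fs_prob_def)
  then show "finite {x \<in> carrier G. \<xi> (h x) \<noteq> 0}"
    using assms(2) by (elim finite_imageD) (auto simp: bij_betw_def inj_on_def)
  have "(\<Sum>\<^sub>\<infinity>x\<in>carrier G. \<xi> (h x)) = infsum \<xi> (carrier G)"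
    using infsum_reindex_bij_betw[OF assms(2), of \<xi>] .
  also have "\<dots> = 1" using fs_prob_infsum[OF assms(1), of "\<lambda>_. 1 :: real"] assms(1) by (simp add: fs_prob_def)
  finally show "(\<Sum>\<^sub>\<infinity>x\<in>carrier G. \<xi> (h x)) = 1" .
qed

lemma bij_betw_inv_mult_right:
  assumes "s \<in> carrier G"
  shows "bij_betw (\<lambda>y. inv (y \<otimes> s)) (carrier G) (carrier G)"
  using bij_betw_trans[OF bij_betw_mult_right[OF assms] bij_betw_inv] by (simp add: comp_def)

text \<open>A strict bound on the infimum yields an actual plan of cost below \<open>C\<close>,
  whether or not the infimum is attained.\<close>

lemma trc_coupling:
  assumes "fs_prob G \<xi>" "s \<in> carrier G"
    and "trc G S (right_reg G s (check G \<xi>)) (check G \<xi>) < C"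
  obtains m where "m \<in> couplings G (right_reg G s (check G \<xi>)) (check G \<xi>)"
    and "(\<Sum>z\<in>{z. m z \<noteq> 0}. real (cay_dist G S (fst z) (snd z)) * m z) < C"
proof -
  let ?M = "couplings G (right_reg G s (check G \<xi>)) (check G \<xi>)"
  have "?M \<noteq> {}"
    using fs_prob_pullback[OF assms(1) bij_betw_inv] assms(1)
      fs_prob_pullback[OF assms(1) bij_betw_inv_mult_right[OF assms(2)]]
    by (intro couplings_nonempty) (auto simp: right_reg_def check_def fs_prob_def)
  then obtain m where m: "m \<in> ?M"
      "(\<Sum>\<^sub>\<infinity>z\<in>carrier G \<times> carrier G. real (cay_dist G S (fst z) (snd z)) * m z) < C"
    using cInf_lessD[OF _ assms(3)[unfolded trc_def]] by auto
  moreover have "(\<Sum>\<^sub>\<infinity>z\<in>carrier G \<times> carrier G. real (cay_dist G S (fst z) (snd z)) * m z)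
      = (\<Sum>z\<in>{z. m z \<noteq> 0}. real (cay_dist G S (fst z) (snd z)) * m z)"
    using m(1) by (intro infsum_eq_sum_superset) (auto simp: couplings_def)
  ultimately show ?thesis using that by simp
qed

section \<open>Averages of left translates\<close>

text \<open>The convolution of \<open>\<xi>\<close> with \<open>f\<close>.\<close>

definition smear :: "('a \<Rightarrow> real) \<Rightarrow> ('a \<Rightarrow> 'k::real_normed_vector) \<Rightarrow> 'a \<Rightarrow> 'k" where
  "smear \<xi> f x = (\<Sum>\<^sub>\<infinity>\<gamma>\<in>carrier G. \<xi> \<gamma> *\<^sub>R left_reg G \<gamma> f x)"

lemma smear_reindex:
  assumes "bij_betw h (carrier G) (carrier G)"
  shows "smear \<xi> f x = (\<Sum>\<^sub>\<infinity>y\<in>carrier G. \<xi> (h y) *\<^sub>R f (inv (h y) \<otimes> x))"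
  unfolding smear_def left_reg_def
  by (rule infsum_reindex_bij_betw[OF assms, of "\<lambda>\<gamma>. \<xi> \<gamma> *\<^sub>R f (inv \<gamma> \<otimes> x)", symmetric])

lemma smear_check: "smear \<xi> f x = (\<Sum>\<^sub>\<infinity>y\<in>carrier G. check G \<xi> y *\<^sub>R f (y \<otimes> x))"
  unfolding smear_reindex[OF bij_betw_inv] check_def by (intro infsum_cong) auto

text \<open>Substituting \<open>\<gamma> = inv (y \<otimes> s)\<close> moves the translation from
  the point to the weights, on the right: the form that the transport bound concerns.\<close>

lemma left_reg_smear_right_reg:
  assumes "s \<in> carrier G" "x \<in> carrier G"
  shows "left_reg G s (smear \<xi> f) x = (\<Sum>\<^sub>\<infinity>y\<in>carrier G. right_reg G s (check G \<xi>) y *\<^sub>R f (y \<otimes> x))"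
  unfolding left_reg_def smear_reindex[OF bij_betw_inv_mult_right[OF assms(1)]] right_reg_def check_def
proof (intro infsum_cong)
  fix y assume y: "y \<in> carrier G"
  have c: "s \<otimes> (inv s \<otimes> x) = x" using assms by (simp add: m_assoc[symmetric])
  have "inv (inv (y \<otimes> s)) \<otimes> (inv s \<otimes> x) = y \<otimes> x"
    using assms y by (simp add: m_assoc c)
  then show "\<xi> (inv (y \<otimes> s)) *\<^sub>R f (inv (inv (y \<otimes> s)) \<otimes> (inv s \<otimes> x)) = \<xi> (inv (y \<otimes> s)) *\<^sub>R f (y \<otimes> x)"
    using assms y by simp
qed

text \<open>Substituting \<open>\<gamma> = inv s \<otimes> y\<close> instead translates the weights
  on the left: the form that asymptotic invariance concerns.\<close>

lemma left_reg_smear_left_reg: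
  assumes "s \<in> carrier G" "x \<in> carrier G"
  shows "left_reg G s (smear \<xi> f) x = (\<Sum>\<^sub>\<infinity>\<gamma>\<in>carrier G. left_reg G s \<xi> \<gamma> *\<^sub>R f (inv \<gamma> \<otimes> x))"
  unfolding left_reg_def smear_reindex[OF bij_betw_mult_left[OF inv_closed[OF assms(1)]]]
proof (intro infsum_cong)
  fix y assume y: "y \<in> carrier G"
  have c: "s \<otimes> (inv s \<otimes> x) = x" using assms by (simp add: m_assoc[symmetric])
  have "inv (inv s \<otimes> y) \<otimes> (inv s \<otimes> x) = inv y \<otimes> x"
    using assms y by (simp add: m_assoc inv_mult_group c)
  then show "\<xi> (inv s \<otimes> y) *\<^sub>R f (inv (inv s \<otimes> y) \<otimes> (inv s \<otimes> x)) = \<xi> (inv s \<otimes> y) *\<^sub>R f (inv y \<otimes> x)"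
    using assms y by simp
qed

text \<open>As \<open>\<xi>\<close> has mass 1, the difference is a finite combination of the
  functions \<open>left_reg G \<gamma> f - f\<close>. The bound depends on \<open>\<xi>\<close>, but
  mere membership in l^p suffices later.\<close>

lemma lp_bdd_smear_diff:
  assumes "\<And>t. t \<in> S \<Longrightarrow> lp_bdd p (carrier G) (\<lambda>x. left_reg G t f x - f x) M"
    and "fin_sym_gen_set G S" "fs_prob G \<xi>" "p \<ge> 1"
  shows "\<exists>R. lp_bdd p (carrier G) (\<lambda>x. f x - smear \<xi> f x) R"
proof -
  let ?P = "{\<gamma>. \<xi> \<gamma> \<noteq> 0}"
  have P: "?P \<subseteq> carrier G" "(\<Sum>\<gamma>\<in>?P. \<xi> \<gamma>) = 1" using assms(3) by (auto simp: fs_prob_def)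
  have "lp_bdd p (carrier G) (\<lambda>x. \<Sum>\<gamma>\<in>?P. (- \<xi> \<gamma>) *\<^sub>R (left_reg G \<gamma> f x - f x))
      (\<Sum>\<gamma>\<in>?P. \<bar>- \<xi> \<gamma>\<bar> * (real (cay_dist G S (inv \<gamma>) \<one>) * M))"
    using assms P by (intro lp_bdd_sum lp_bdd_scaleR lp_bdd_left_reg) auto
  moreover have "(\<Sum>\<gamma>\<in>?P. (- \<xi> \<gamma>) *\<^sub>R (left_reg G \<gamma> f x - f x)) = f x - smear \<xi> f x" for x
  proof -
    have "(\<Sum>\<gamma>\<in>?P. (- \<xi> \<gamma>) *\<^sub>R (left_reg G \<gamma> f x - f x))
        = (\<Sum>\<gamma>\<in>?P. \<xi> \<gamma>) *\<^sub>R f x - (\<Sum>\<gamma>\<in>?P. \<xi> \<gamma> *\<^sub>R left_reg G \<gamma> f x)"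
      by (simp add: scaleR_sum_left sum_subtractf scaleR_diff_right)
    then show ?thesis by (simp add: P(2) smear_def fs_prob_infsum[OF assms(3)])
  qed
  ultimately show ?thesis by auto
qed

text \<open>Integrating the gradient of \<open>f\<close> along a transport plan; right translation preserves the norm.\<close>
lemma lp_bdd_left_reg_smear:
  assumes f: "\<And>t. t \<in> S \<Longrightarrow> lp_bdd p (carrier G) (\<lambda>x. left_reg G t f x - f x) M" and "M \<ge> 0"
    and S: "fin_sym_gen_set G S" and \<xi>: "fs_prob G \<xi>" and p: "p \<ge> 1" and s: "s \<in> carrier G"
    and C: "trc G S (right_reg G s (check G \<xi>)) (check G \<xi>) < C"
  shows "lp_bdd p (carrier G) (\<lambda>x. left_reg G s (smear \<xi> f) x - smear \<xi> f x) (C * M)"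
proof -
  obtain m where m: "m \<in> couplings G (right_reg G s (check G \<xi>)) (check G \<xi>)"
    and cost: "(\<Sum>z\<in>{z. m z \<noteq> 0}. real (cay_dist G S (fst z) (snd z)) * m z) < C"
    using trc_coupling[OF \<xi> s C] .
  let ?P = "{z. m z \<noteq> 0}"
  have P: "?P \<subseteq> carrier G \<times> carrier G" "\<And>z. m z \<ge> 0" using m by (auto simp: couplings_def)
  have "lp_bdd p (carrier G) (\<lambda>x. \<Sum>z\<in>?P. m z *\<^sub>R (f (fst z \<otimes> x) - f (snd z \<otimes> x)))
      (\<Sum>z\<in>?P. \<bar>m z\<bar> * (real (cay_dist G S (fst z) (snd z)) * M))"
    using P f S p by (intro lp_bdd_sum lp_bdd_scaleR lp_bdd_cay_dist) auto
  moreover have "(\<Sum>z\<in>?P. \<bar>m z\<bar> * (real (cay_dist G S (fst z) (snd z)) * M)) \<le> C * M"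
  proof -
    have "(\<Sum>z\<in>?P. \<bar>m z\<bar> * (real (cay_dist G S (fst z) (snd z)) * M))
        = (\<Sum>z\<in>?P. real (cay_dist G S (fst z) (snd z)) * m z) * M"
      unfolding sum_distrib_right using P by (intro sum.cong) auto
    then show ?thesis using cost \<open>M \<ge> 0\<close> by (simp add: mult_right_mono)
  qed
  moreover have "(\<Sum>z\<in>?P. m z *\<^sub>R (f (fst z \<otimes> x) - f (snd z \<otimes> x)))
      = left_reg G s (smear \<xi> f) x - smear \<xi> f x" if "x \<in> carrier G" for x
    unfolding left_reg_smear_right_reg[OF s that] smear_check couplings_infsum_diff[OF m] ..
  ultimately show ?thesis using p by (elim lp_bdd_mono) auto
qed

text \<open>Pairs the l^1 defect of invariance of \<open>\<xi>\<close> with the bounded function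
  \<open>f\<close>; this gives the pointwise decay of the gradients.\<close>

lemma norm_left_reg_smear_le:
  assumes \<xi>: "fs_prob G \<xi>" and s: "s \<in> carrier G" and x: "x \<in> carrier G"
    and B: "\<And>x. norm (f x) \<le> B"
  shows "norm (left_reg G s (smear \<xi> f) x - smear \<xi> f x)
    \<le> (\<Sum>\<^sub>\<infinity>\<gamma>\<in>carrier G. \<bar>left_reg G s \<xi> \<gamma> - \<xi> \<gamma>\<bar>) * B"
proof -
  define A where "A = {\<gamma>. \<xi> \<gamma> \<noteq> 0} \<union> {\<gamma> \<in> carrier G. \<xi> (inv s \<otimes> \<gamma>) \<noteq> 0}"
  have A: "finite A" "A \<subseteq> carrier G"
    using \<xi> fs_prob_pullback(1)[OF \<xi> bij_betw_mult_left[OF inv_closed[OF s]]]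
    by (auto simp: A_def fs_prob_def)
  have off: "\<xi> \<gamma> = 0" "left_reg G s \<xi> \<gamma> = 0" if "\<gamma> \<in> carrier G - A" for \<gamma>
    using that by (auto simp: A_def left_reg_def)
  have "left_reg G s (smear \<xi> f) x - smear \<xi> f x
      = (\<Sum>\<gamma>\<in>A. left_reg G s \<xi> \<gamma> *\<^sub>R f (inv \<gamma> \<otimes> x)) - (\<Sum>\<gamma>\<in>A. \<xi> \<gamma> *\<^sub>R f (inv \<gamma> \<otimes> x))"
    unfolding left_reg_smear_left_reg[OF s x] smear_def left_reg_def[of G _ f]
    using A off by (intro arg_cong2[of _ _ _ _ "(-)"] infsum_eq_sum_superset) auto
  also have "\<dots> = (\<Sum>\<gamma>\<in>A. (left_reg G s \<xi> \<gamma> - \<xi> \<gamma>) *\<^sub>R f (inv \<gamma> \<otimes> x))"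
    by (simp add: sum_subtractf scaleR_diff_left)
  also have "norm \<dots> \<le> (\<Sum>\<gamma>\<in>A. \<bar>left_reg G s \<xi> \<gamma> - \<xi> \<gamma>\<bar> * B)"
    by (intro sum_norm_le) (auto simp: B mult_left_mono)
  also have "\<dots> = (\<Sum>\<gamma>\<in>A. \<bar>left_reg G s \<xi> \<gamma> - \<xi> \<gamma>\<bar>) * B"
    by (simp add: sum_distrib_right)
  also have "(\<Sum>\<gamma>\<in>A. \<bar>left_reg G s \<xi> \<gamma> - \<xi> \<gamma>\<bar>) = (\<Sum>\<^sub>\<infinity>\<gamma>\<in>carrier G. \<bar>left_reg G s \<xi> \<gamma> - \<xi> \<gamma>\<bar>)"
    using A off by (intro infsum_eq_sum_superset[symmetric]) auto
  finally show ?thesis .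
qed

section \<open>Approximation of bounded Dirichlet functions\<close>

lemma bounded_Dirichlet_approx:
  fixes f :: "'a \<Rightarrow> 'k::real_normed_field"
  assumes "transport_amenable G" and S: "fin_sym_gen_set G S" and p: "p > 1"
    and f: "lp_bdd p (cay_edges G S) (grad f) R" and B: "\<And>x. norm (f x) \<le> B" and \<epsilon>: "\<epsilon> > 0"
  shows "\<exists>g. lp_set p (carrier G) g \<and> lp_bdd p (cay_edges G S) (grad (\<lambda>x. f x - g x)) \<epsilon>"
proof -
  obtain T C \<xi> where T: "fin_sym_gen_set G T" and "C > 0"
    and \<xi>: "\<And>n. fs_prob G (\<xi> n)" and mean: "conv_left_inv_mean G \<xi>"
    and C: "\<And>s n. s \<in> T \<Longrightarrow> trc G T (right_reg G s (check G (\<xi> n))) (check G (\<xi> n)) \<le> C"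
    using assms(1) unfolding transport_amenable_def by blast
  have p1: "p \<ge> 1" "p > 0" using p by auto
  have fin: "finite S" "finite T" "S \<subseteq> carrier G" "T \<subseteq> carrier G"
    using S T by (auto simp: fin_sym_gen_set_def)
  have fS: "lp_bdd p (carrier G) (\<lambda>x. left_reg G s f x - f x) R" if "s \<in> S" for s
    using lp_bdd_gradD[OF f that] .
  \<comment> \<open>The set \<open>T\<close> from transport amenability may differ from
    \<open>S\<close>: bounds pass from \<open>S\<close> to \<open>T\<close> here and back to
    \<open>S\<close> in \<open>FS\<close>. Summing over \<open>T\<close> gives one constant for all
    its elements.\<close>
  define M where "M = (\<Sum>t\<in>T. real (cay_dist G S (inv t) \<one>)) * R"
  have R: "R \<ge> 0" using lp_bdd_nonneg[OF f] .
  then have M: "M \<ge> 0" by (simp add: M_def sum_nonneg)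
  have fT: "lp_bdd p (carrier G) (\<lambda>x. left_reg G t f x - f x) M" if t: "t \<in> T" for t
  proof -
    have "lp_bdd p (carrier G) (\<lambda>x. left_reg G t f x - f x) (real (cay_dist G S (inv t) \<one>) * R)"
      using fS S t fin p1 by (intro lp_bdd_left_reg) auto
    moreover have "real (cay_dist G S (inv t) \<one>) \<le> (\<Sum>t\<in>T. real (cay_dist G S (inv t) \<one>))"
      using fin t by (intro member_le_sum) auto
    ultimately show ?thesis
      using p1 R by (elim lp_bdd_mono) (auto simp: M_def intro: mult_right_mono)
  qed
  let ?F = "\<lambda>n. smear (\<xi> n) f"
  \<comment> \<open>\<open>C + 1\<close> turns the cost bound into the strict inequality required
    for choosing a plan.\<close>
  have "lp_bdd p (carrier G) (\<lambda>x. left_reg G t (?F n) x - ?F n x) ((C + 1) * M)" if t: "t \<in> T" for t n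
    using fT M T \<xi> p1 t fin C[OF t, of n] by (intro lp_bdd_left_reg_smear) auto
  then have FS: "lp_bdd p (carrier G) (\<lambda>x. left_reg G s (?F n) x - ?F n x)
      (real (cay_dist G T (inv s) \<one>) * ((C + 1) * M))" if "s \<in> S" for s n
    using T that fin p1 by (intro lp_bdd_left_reg) auto
  \<comment> \<open>This bound is uniform in \<open>n\<close>, as the averaging lemma
    requires.\<close>
  define Q where "Q = (\<Sum>s\<in>S. (real (cay_dist G T (inv s) \<one>) * ((C + 1) * M)) powr p) powr (1 / p)"
  have bdd: "lp_bdd p (cay_edges G S) (grad (?F n)) Q" for n
    unfolding Q_def using FS fin p1 by (intro lp_bdd_gradI) auto
  have lim: "(\<lambda>n. grad (?F n) e) \<longlonglongrightarrow> 0" if e: "e \<in> cay_edges G S" for e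
  proof -
    obtain s x where sx: "s \<in> S" "x \<in> carrier G" "e = (x, inv s \<otimes> x)"
      using e by (auto simp: cay_edges_def)
    then have s: "s \<in> carrier G" using fin by auto
    let ?l = "\<lambda>n. \<Sum>\<^sub>\<infinity>\<gamma>\<in>carrier G. \<bar>left_reg G s (\<xi> n) \<gamma> - \<xi> n \<gamma>\<bar>"
    have "?l \<longlonglongrightarrow> 0" using mean s by (simp add: conv_left_inv_mean_def)
    then have l: "(\<lambda>n. ?l n * B) \<longlonglongrightarrow> 0" by (rule tendsto_mult_left_zero)
    have "norm (grad (?F n) e) \<le> ?l n * B" for n
      using norm_left_reg_smear_le[OF \<xi> s sx(2) B] by (simp add: sx(3) grad_def left_reg_def)
    then show ?thesis by (intro Lim_null_comparison[OF always_eventually l] allI)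
  qed
  obtain N \<nu> where N: "N > 0"
    and avg: "lp_bdd p (cay_edges G S) (\<lambda>e. (1 / real N) *\<^sub>R (\<Sum>k<N. grad (?F (\<nu> k)) e)) \<epsilon>"
    using lp_bdd_average_null_sequence[OF bdd lim p \<epsilon>] .
  \<comment> \<open>Chosen so that \<open>f - g\<close> is the average of the
    \<open>?F (\<nu> k)\<close>, while \<open>g\<close> is a finite combination of l^p
    functions.\<close>
  define g where "g x = (\<Sum>k<N. (1 / real N) *\<^sub>R (f x - ?F (\<nu> k) x))" for x
  have g: "f x - g x = (1 / real N) *\<^sub>R (\<Sum>k<N. ?F (\<nu> k) x)" for x
  proof -
    have "g x = (1 / real N) *\<^sub>R (real N *\<^sub>R f x - (\<Sum>k<N. ?F (\<nu> k) x))"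
      by (simp only: g_def scaleR_sum_right[symmetric] sum_subtractf sum_constant_scaleR card_lessThan)
    then show ?thesis using N by (simp add: scaleR_diff_right)
  qed
  have "\<forall>n. \<exists>R. lp_bdd p (carrier G) (\<lambda>x. f x - ?F n x) R"
    using lp_bdd_smear_diff[OF fS S \<xi> p1(1)] by auto
  then obtain r where "\<And>n. lp_bdd p (carrier G) (\<lambda>x. f x - ?F n x) (r n)" by metis
  then have "lp_bdd p (carrier G) g (\<Sum>k<N. \<bar>1 / real N\<bar> * r (\<nu> k))"
    unfolding g_def using p1 by (intro lp_bdd_sum lp_bdd_scaleR) auto
  then have "lp_set p (carrier G) g" by (rule lp_bdd_imp_lp_set)
  moreover have "grad (\<lambda>x. f x - g x) = (\<lambda>e. (1 / real N) *\<^sub>R (\<Sum>k<N. grad (?F (\<nu> k)) e))"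
    unfolding g by (simp add: grad_def fun_eq_iff sum_subtractf scaleR_diff_right)
  ultimately show ?thesis using avg by auto
qed

end

section \<open>Truncation and the general case\<close>

text \<open>Project the values onto a ball containing all values of \<open>f\<close> at endpoints of
  a finite edge set \<open>A\<close> that carries most of the gradient. Nothing changes on
  \<open>A\<close>; elsewhere the projection is 1-Lipschitz, so the gradient of \<open>f - h\<close>
  is at most twice that of \<open>f\<close>.\<close>

lemma Dirichlet_truncation:
  fixes f :: "'a \<Rightarrow> 'k::{real_normed_field, euclidean_space}"
  assumes f: "lp_bdd p E (grad f) R" and p: "p > 0" and \<epsilon>: "\<epsilon> > 0"
  shows "\<exists>h B. (\<forall>x. norm (h x) \<le> B) \<and> lp_bdd p E (grad (\<lambda>x. f x - h x)) \<epsilon>"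
proof -
  obtain A where A: "finite A" "A \<subseteq> E" "lp_bdd p (E - A) (grad f) (\<epsilon> / 2)"
    using lp_bdd_tail[OF f, of "\<epsilon> / 2"] \<epsilon> by auto
  define B where "B = (\<Sum>e\<in>A. norm (f (fst e)) + norm (f (snd e)))"
  define h where "h x = closest_point (cball 0 B) (f x)" for x
  have B: "B \<ge> 0" by (simp add: B_def sum_nonneg)
  then have ne: "cball (0::'k) B \<noteq> {}" by simp
  have "norm (h x) \<le> B" for x
    using closest_point_in_set[OF closed_cball ne, of "f x"] by (simp add: h_def)
  moreover have "lp_bdd p E (grad (\<lambda>x. f x - h x)) \<epsilon>"
  proof (rule lp_bddI)
    let ?v = "grad (\<lambda>x. f x - h x)"
    have zero: "?v e = 0" if "e \<in> A" for e
    proof -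
      have "norm (f (fst e)) + norm (f (snd e)) \<le> B"
        unfolding B_def using A that by (intro member_le_sum) auto
      then have "f (fst e) \<in> cball 0 B" "f (snd e) \<in> cball 0 B"
        using norm_ge_zero[of "f (fst e)"] norm_ge_zero[of "f (snd e)"] by (auto simp del: norm_ge_zero)
      then show ?thesis by (simp add: grad_def h_def closest_point_self)
    qed
    have "norm (?v e) \<le> norm (2 *\<^sub>R grad f e)" for e
    proof -
      have "norm (h (snd e) - h (fst e)) \<le> norm (grad f e)"
        using closest_point_lipschitz[OF convex_cball closed_cball ne, of "f (snd e)" "f (fst e)"]
        by (simp add: h_def grad_def dist_norm)
      moreover have "?v e = grad f e - (h (snd e) - h (fst e))" by (simp add: grad_def)
      ultimately show ?thesis
        using norm_triangle_ineq4[of "grad f e" "h (snd e) - h (fst e)"] by simp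
    qed
    then have off: "lp_bdd p (E - A) ?v \<epsilon>"
      using lp_bdd_scaleR[OF A(3), of 2] p by (elim lp_bdd_mono) auto
    fix F assume F: "finite F" "F \<subseteq> E"
    have "(\<Sum>e\<in>F. norm (?v e) powr p) = (\<Sum>e\<in>F - A. norm (?v e) powr p)"
      using F zero by (intro sum.mono_neutral_right) auto
    also have "\<dots> \<le> \<epsilon> powr p" using F by (intro lp_bddD[OF off]) auto
    finally show "(\<Sum>e\<in>F. norm (?v e) powr p) \<le> \<epsilon> powr p" .
  qed (use \<epsilon> in simp)
  ultimately show ?thesis by blast
qed

text \<open>The scalar type covers the real and complex cases together. Truncation and the bounded
  case each cost \<open>\<epsilon> / 4\<close>, which leaves room for the strict inequality.\<close>

lemma (in group) reduced_lp_H1_vanishes_if_transport_amenable: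
  assumes amen: "transport_amenable G" and S: "fin_sym_gen_set G S" and p: "p > 1"
  shows "reduced_lp_H1_vanishes G S p TYPE('a \<Rightarrow> 'k::{real_normed_field, euclidean_space})"
  unfolding reduced_lp_H1_vanishes_def
proof (intro allI impI)
  fix f :: "'a \<Rightarrow> 'k" and \<epsilon> :: real
  assume "Dp G S p f" and \<epsilon>: "\<epsilon> > 0"
  let ?E = "cay_edges G S"
  obtain R where f: "lp_bdd p ?E (grad f) R"
    using lp_set_imp_lp_bdd[of p ?E "grad f"] \<open>Dp G S p f\<close> p unfolding Dp_def by auto
  obtain h B where B: "\<And>x. norm (h x) \<le> B" and fh: "lp_bdd p ?E (grad (\<lambda>x. f x - h x)) (\<epsilon> / 4)"
    using Dirichlet_truncation[OF f, of "\<epsilon> / 4"] p \<epsilon> by auto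
  have "lp_bdd p ?E (\<lambda>e. grad f e + - grad (\<lambda>x. f x - h x) e) (R + \<epsilon> / 4)"
    using p by (intro lp_bdd_add f lp_bdd_minus[OF fh]) auto
  then have "lp_bdd p ?E (grad h) (R + \<epsilon> / 4)"
    by (subst (asm) lp_bdd_cong[of _ _ "grad h"]) (auto simp: grad_def)
  then obtain g where g: "lp_set p (carrier G) g" and hg: "lp_bdd p ?E (grad (\<lambda>x. h x - g x)) (\<epsilon> / 4)"
    using bounded_Dirichlet_approx[OF amen S p, of h "R + \<epsilon> / 4" B "\<epsilon> / 4"] B \<epsilon> by auto
  \<comment> \<open>This constant makes the base point term of \<open>Dp_norm\<close> vanish without
    affecting the gradient.\<close>
  define c where "c = f \<one> - g \<one>"
  have "lp_bdd p ?E (\<lambda>e. grad (\<lambda>x. f x - h x) e + grad (\<lambda>x. h x - g x) e) (\<epsilon> / 4 + \<epsilon> / 4)"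
    using p by (intro lp_bdd_add fh hg) auto
  then have fg: "lp_bdd p ?E (grad (\<lambda>x. f x - g x - c)) (\<epsilon> / 2)"
    by (subst (asm) lp_bdd_cong[of _ _ "grad (\<lambda>x. f x - g x - c)"]) (auto simp: grad_def)
  have "Dp_norm G S p (\<lambda>x. f x - g x - c) \<le> ((\<epsilon> / 2) powr p) powr (1 / p)"
    unfolding Dp_norm_def using lp_bdd_infsum_le[OF fg] p
    by (intro powr_mono2) (auto simp: c_def infsum_nonneg)
  also have "\<dots> < \<epsilon>" using \<epsilon> p by (simp add: powr_powr)
  finally show "\<exists>g c. lp_set p (carrier G) g \<and> Dp G S p (\<lambda>x. f x - g x - c)
      \<and> Dp_norm G S p (\<lambda>x. f x - g x - c) < \<epsilon>"
    using g lp_bdd_imp_lp_set[OF fg] by (auto simp: Dp_def)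
qed

theorem theorem1p3:
  fixes G :: "('a, 'b) monoid_scheme"
  assumes "group G"
    and "finitely_generated G"
    and "transport_amenable G"
    and "p > 1"
  shows "\<forall>S. fin_sym_gen_set G S \<longrightarrow>
           reduced_lp_H1_vanishes G S p TYPE('a \<Rightarrow> real)
         \<and> reduced_lp_H1_vanishes G S p TYPE('a \<Rightarrow> complex)"
  using assms by (intro allI impI conjI group.reduced_lp_H1_vanishes_if_transport_amenable)

end
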